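(* Let $\lambda_{ij}>0$ for $1\le i\le m$ and $1\le j\le n$, let $\nu_i=\sum_{j=1}^n\lambda_{ij}$ for $1\le i\le m$ and $\tau_j=\sum_{i=1}^m\lambda_{ij}$ for $1\le j\le n$, let $\rho,\theta\in\mathbb{R}$, and define, for $t\in(0,\infty)$, $$F(t)=\frac{\prod_{i=1}^{m}[\Gamma(1+\nu_it)]^{\nu_i^\theta}\prod_{j=1}^n[\Gamma(1+\tau_jt)]^{\tau_j^\theta}}{\prod_{i=1}^m\prod_{j=1}^{n}[\Gamma(1+\lambda_{ij}t)]^{\rho\lambda_{ij}^\theta}}.$$ The function $F(t)$ has the following properties: (1) If $\rho\le2$ and $\theta\ge0$, the second derivative $[\ln F(t)]''$ is completely monotonic and maps from $(0,\infty)$ onto the interval $$\Biggl(0,\frac{\pi^2}{6}\Biggl(\sum_{i=1}^m\nu_i^{\theta+2}+\sum_{j=1}^n\tau_j^{\theta+2}-\rho\sum_{i=1}^m\sum_{j=1}^n\lambda_{ij}^{\theta+2}\Biggr)\Biggr).$$ (2) If $\rho\le2$ and $\theta\ge0$, the logarithmic derivative $[\ln F(t)]'=\frac{F'(t)}{F(t)}$ is increasing and concave on $(0,\infty)$. Within this case: (a) if $\rho=2$ and $\theta=0$, the logarithmic derivative $[\ln F(t)]'$ maps $(0,\infty)$ onto $$\left(0,\ln\frac{\prod_{i=1}^m\nu_i^{\nu_i}\prod_{j=1}^n\tau_j^{\tau_j}}{\bigl(\prod_{i=1}^m\prod_{j=1}^n\lambda_{ij}^{\lambda_{ij}}\bigr)^2}\right)$$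 and, consequently, is a Bernstein function on $(0,\infty)$; (b) if $\rho<2$ or $\theta>0$, the logarithmic derivative $[\ln F(t)]'$ maps $(0,\infty)$ onto $$\Biggl(-\gamma\Biggl(\sum_{i=1}^m\nu_i^{\theta+1}+\sum_{j=1}^n\tau_j^{\theta+1}-\rho\sum_{i=1}^m\sum_{j=1}^n\lambda_{ij}^{\theta+1}\Biggr),\infty\Biggr),$$ where $\gamma=0.57721566\dotsc$ is the Euler--Mascheroni constant. (3) If $\rho\le2$ and $\theta\ge0$, the function $F(t)$ is logarithmically convex on $(0,\infty)$. Within this case: (a) if $\rho=2$ and $\theta=0$, the function $F(t)$ is increasing and maps $(0,\infty)$ onto $(1,\infty)$; (b) if $\rho<2$ or $\theta>0$, the function $F(t)$ has a unique minimum and the limits $$\lim_{t\to0^+}F(t)=1\quad\text{and}\quad\lim_{t\to\infty}F(t)=\infty.$$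
   Context: Here $m,n$ are positive integers and $\Gamma$ is the classical gamma function. A real-valued function $g$ on an interval $I$ is completely monotonic on $I$ if $(-1)^kg^{(k)}(x)\ge0$ for all integers $k\ge0$ and all $x\in I$. A nonnegative function on an interval $I$ is a Bernstein function if its derivative is completely monotonic on $I$. A positive function $g$ is logarithmically convex if $\ln g$ is convex.
   Formalization: In the case m=n=1, ρ=2, where F is identically 1, the "onto" claims in (1), (2a), (2b), (3a), strict increase, and the unique minimum and limit ∞ in (3b) are false and are not asserted; all other claims are stated in full. *)

theory Defs
  imports "HOL-Analysis.Analysis"
begin

text \<open>
  The intervals \<open>I\<close> below are meant to be open: \<^const>\<open>deriv\<close> is the two-sided derivative.
  As \<^const>\<open>deriv\<close> is total, the existence of all derivatives has to be demanded explicitly.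
\<close>

definition completely_monotonic_on :: "real set \<Rightarrow> (real \<Rightarrow> real) \<Rightarrow> bool" where
  "completely_monotonic_on I g \<longleftrightarrow>
     (\<forall>k. \<forall>x\<in>I. (deriv ^^ k) g differentiable (at x) \<and> (-1) ^ k * (deriv ^^ k) g x \<ge> 0)"

definition Bernstein_on :: "real set \<Rightarrow> (real \<Rightarrow> real) \<Rightarrow> bool" where
  "Bernstein_on I g \<longleftrightarrow>
     (\<forall>x\<in>I. g x \<ge> 0 \<and> g differentiable (at x)) \<and> completely_monotonic_on I (deriv g)"

definition log_convex_on :: "real set \<Rightarrow> (real \<Rightarrow> real) \<Rightarrow> bool" where
  "log_convex_on I g \<longleftrightarrow> (\<forall>x\<in>I. g x > 0) \<and> convex_on I (\<lambda>x. ln (g x))"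

end

theory Submission
  imports Defs
begin

text \<open>
  The derivative of order \<open>n + 1\<close> of \<open>ln F\<close> is a signed sum of the values of
  \<open>f a = a powr (\<theta> + n + 1) * Polygamma n (1 + a * t)\<close> at the row sums, the column sums and the
  entries. All sign statements follow from superadditivity of \<open>\<bar>f\<bar>\<close> for \<open>n \<ge> 1\<close>, that is, from
  monotonicity of \<open>\<bar>f a\<bar> / a\<close>, which reduces to that of \<open>x ^ n * \<bar>Polygamma n (1 + x)\<bar>\<close> in
  \<open>x > 0\<close>. The latter amounts to
  \<open>x * \<bar>Polygamma (n + 1) (1 + x)\<bar> < n * \<bar>Polygamma n (1 + x)\<bar>\<close>, which is obtained by comparing
  \<open>x\<close> with \<open>x + 1\<close> and iterating the shift. The behaviour of the logarithmic derivative at infinity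
  comes from \<open>0 \<le> Digamma (1 + x) - ln x \<le> 1 / x\<close>.
\<close>

section \<open>Polygamma functions on the positive reals\<close>

text \<open>For \<open>n = 0\<close> this is \<open>- Digamma\<close>, which is not of constant sign.\<close>
definition abs_Polygamma :: "nat \<Rightarrow> real \<Rightarrow> real" where
  "abs_Polygamma n x = (-1) ^ Suc n * Polygamma n x"

lemma pos_real_not_nonpos_Int: "(x::real) > 0 \<Longrightarrow> x \<notin> \<int>\<^sub>\<le>\<^sub>0"
  by (auto simp: nonpos_Ints_def)

lemma abs_Polygamma_pos:
  assumes "n > 0" "x > 0"
  shows "abs_Polygamma n x > 0"
  using assms Polygamma_real_odd_pos[of x n] Polygamma_real_even_neg[of x n]
  by (cases "even n") (auto simp: abs_Polygamma_def pos_real_not_nonpos_Int)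

lemma has_real_derivative_Polygamma:
  assumes "(x::real) > 0"
  shows "(Polygamma n has_real_derivative Polygamma (Suc n) x) (at x)"
  using assms by (intro has_field_derivative_Polygamma pos_real_not_nonpos_Int)

text \<open>The sign convention makes differentiation a shift of the index with a minus sign,
  uniformly in the parity of \<open>n\<close>.\<close>

lemma has_real_derivative_abs_Polygamma:
  assumes "x > 0"
  shows "(abs_Polygamma n has_real_derivative - abs_Polygamma (Suc n) x) (at x)"
  unfolding abs_Polygamma_def[abs_def]
  by (rule derivative_eq_intros has_real_derivative_Polygamma assms refl | simp)+

text \<open>The derivative is \<open>- abs_Polygamma (Suc n) z\<close>, whose index is positive, so
  it is negative even for \<open>n = 0\<close>.\<close>

lemma abs_Polygamma_strict_antimono:
  assumes "0 < x" "x < y"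
  shows "abs_Polygamma n y < abs_Polygamma n x"
proof (rule DERIV_neg_imp_decreasing[OF assms(2)])
  fix z assume "x \<le> z" "z \<le> y"
  with assms have "z > 0" by simp
  then show "\<exists>D. (abs_Polygamma n has_real_derivative D) (at z) \<and> D < 0"
    by (intro exI[of _ "- abs_Polygamma (Suc n) z"] conjI has_real_derivative_abs_Polygamma)
      (simp_all add: abs_Polygamma_pos)
qed

lemma abs_Polygamma_plus1:
  assumes "x > 0"
  shows "abs_Polygamma n (x + 1) = abs_Polygamma n x - fact n / x ^ Suc n"
proof -
  \<comment> \<open>The recurrence of \<open>Polygamma n\<close> adds a term of sign
    \<open>(-1) ^ n\<close>; against the factor \<open>(-1) ^ Suc n\<close> it becomes a plain
    subtraction.\<close>
  have "((-1::real) ^ n) * (-1) ^ n = 1"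
    by (simp flip: power_mult_distrib)
  then show ?thesis
    using assms Polygamma_plus1[of x n] by (simp add: abs_Polygamma_def algebra_simps)
qed

text \<open>By the mean value theorem and the recurrence, \<open>fact n / x ^ Suc n\<close> is the
  value of the strictly decreasing function \<open>abs_Polygamma (Suc n)\<close> at a point strictly
  between \<open>x\<close> and \<open>x + 1\<close>.\<close>

lemma abs_Polygamma_Suc_bounds:
  assumes "x > 0"
  shows "abs_Polygamma (Suc n) (x + 1) < fact n / x ^ Suc n"
    and "fact n / x ^ Suc n < abs_Polygamma (Suc n) x"
proof -
  obtain z where z: "x < z" "z < x + 1"
    "abs_Polygamma n (x + 1) - abs_Polygamma n x = (x + 1 - x) * - abs_Polygamma (Suc n) z"
    using MVT2[of x "x + 1" "abs_Polygamma n" "\<lambda>z. - abs_Polygamma (Suc n) z"] assms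
      has_real_derivative_abs_Polygamma[of _ n] by auto
  then have eq: "fact n / x ^ Suc n = abs_Polygamma (Suc n) z"
    using abs_Polygamma_plus1[OF assms, of n] by simp
  show "abs_Polygamma (Suc n) (x + 1) < fact n / x ^ Suc n"
    and "fact n / x ^ Suc n < abs_Polygamma (Suc n) x"
    unfolding eq using z assms by (auto intro!: abs_Polygamma_strict_antimono)
qed

lemma tendsto_abs_Polygamma_at_top: "(abs_Polygamma (Suc k) \<longlongrightarrow> 0) at_top"
proof (rule tendsto_sandwich)
  show "\<forall>\<^sub>F x in at_top. 0 \<le> abs_Polygamma (Suc k) x"
    using eventually_gt_at_top[of 0]
    by eventually_elim (simp add: abs_Polygamma_pos less_imp_le)
  show "\<forall>\<^sub>F x in at_top. abs_Polygamma (Suc k) x \<le> fact k / (x - 1) ^ Suc k"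
    using eventually_gt_at_top[of 1]
  proof eventually_elim
    case (elim x)
    with abs_Polygamma_Suc_bounds(1)[of "x - 1" k] show ?case by simp
  qed
  have "filterlim (\<lambda>x::real. (x - 1) ^ Suc k) at_top at_top"
    by (intro filterlim_pow_at_top filterlim_tendsto_add_at_top[of "\<lambda>_. -1" "-1" at_top "\<lambda>x. x", simplified]
        filterlim_ident) simp
  then show "((\<lambda>x::real. fact k / (x - 1) ^ Suc k) \<longlongrightarrow> 0) at_top"
    by (intro tendsto_divide_0[OF tendsto_const] filterlim_at_top_imp_at_infinity)
qed simp

text \<open>The difference of the two sides decreases under \<open>x \<mapsto> x + 1\<close> and has a nonnegative lower limit
  at infinity.\<close>
lemma mult_abs_Polygamma_Suc_less:
  assumes n: "n > 0" and x: "x > 0"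
  shows "x * abs_Polygamma (Suc n) (1 + x) < n * abs_Polygamma n (1 + x)"
proof -
  define E where "E y = n * abs_Polygamma n (1 + y) - y * abs_Polygamma (Suc n) (1 + y)" for y
  have step: "E (y + 1) < E y" if "y > 0" for y
  proof -
    define u where "u = y + 1"
    define q where "q = fact n / u ^ Suc n"
    have u: "u > 0" "1 + y = u" "1 + (y + 1) = u + 1" "y = u - 1" using that by (auto simp: u_def)
    have 1: "abs_Polygamma n (u + 1) = abs_Polygamma n u - q"
      using abs_Polygamma_plus1[OF u(1), of n] by (simp add: q_def)
    have 2: "abs_Polygamma (Suc n) (u + 1) = abs_Polygamma (Suc n) u - (n + 1) * q / u"
      using abs_Polygamma_plus1[OF u(1), of "Suc n"] by (simp add: q_def algebra_simps)
    \<comment> \<open>With every argument expressed through \<open>u\<close>, the corrections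
      \<open>n * q\<close> and \<open>(n + 1) * q\<close> cancel up to a single
      \<open>q\<close>.\<close>
    have "E y - E (y + 1) = abs_Polygamma (Suc n) u - q"
      unfolding E_def u(2,3) 1 2 unfolding u(4) using u(1) by (simp add: field_simps)
    then show ?thesis
      using abs_Polygamma_Suc_bounds(2)[OF u(1), of n] by (simp add: q_def)
  qed
  \<comment> \<open>The iteration starts at \<open>x + 1\<close>, which saves the strict step from
    \<open>x\<close> to \<open>x + 1\<close> for the end.\<close>
  have dec: "E (x + 1 + real N) \<le> E (x + 1)" for N
  proof (induction N)
    case (Suc N)
    then show ?case using step[of "x + 1 + real N"] x by (simp add: add_ac)
  qed simp
  have lower: "- (fact n / y ^ n) \<le> E y" if "y > 0" for y
  proof -
    have "y * abs_Polygamma (Suc n) (1 + y) \<le> y * (fact n / y ^ Suc n)"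
      using abs_Polygamma_Suc_bounds(1)[OF that, of n] that
      by (intro mult_left_mono) (simp_all add: add_ac)
    also have "\<dots> = fact n / y ^ n" using that by simp
    moreover have "0 \<le> n * abs_Polygamma n (1 + y)"
      using abs_Polygamma_pos[of n "1 + y"] n that by simp
    ultimately show ?thesis by (simp add: E_def)
  qed
  have "(\<lambda>N. - (fact n / (x + 1 + real N) ^ n)) \<longlonglongrightarrow> - 0"
    using n by (intro tendsto_minus tendsto_divide_0[OF tendsto_const]
        filterlim_at_top_imp_at_infinity filterlim_pow_at_top
        filterlim_tendsto_add_at_top[OF tendsto_const filterlim_real_sequentially])
  \<comment> \<open>\<open>E (x + 1)\<close> dominates \<open>E (x + 1 + N)\<close>, hence
    \<open>- (fact n / (x + 1 + N) ^ n)\<close>, which tends to 0 because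
    \<open>n > 0\<close>.\<close>
  then have "0 \<le> E (x + 1)"
    using lower[of "x + 1 + real _"] dec x
    by (intro tendsto_upperbound[of _ "-0" sequentially "E (x + 1)", simplified])
      (auto intro!: always_eventually order.trans[OF lower dec])
  with step[OF x] show ?thesis by (simp add: E_def)
qed

text \<open>The derivative is \<open>z ^ (n - 1)\<close> times the difference shown to be positive
  in \<open>mult_abs_Polygamma_Suc_less\<close>.\<close>

lemma power_mult_abs_Polygamma_strict_mono:
  assumes n: "n > 0" and "0 < x" "x < y"
  shows "x ^ n * abs_Polygamma n (1 + x) < y ^ n * abs_Polygamma n (1 + y)"
proof (rule DERIV_pos_imp_increasing[OF \<open>x < y\<close>])
  fix z assume "x \<le> z" "z \<le> y"
  with assms have z: "z > 0" by simp
  obtain k where k: "n = Suc k" using n by (cases n) auto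
  let ?D = "z ^ k * (n * abs_Polygamma n (1 + z) - z * abs_Polygamma (Suc n) (1 + z))"
  have "((\<lambda>z. abs_Polygamma n (1 + z)) has_real_derivative - abs_Polygamma (Suc n) (1 + z)) (at z)"
    using DERIV_shift[of "abs_Polygamma n" _ z 1] has_real_derivative_abs_Polygamma[of "z + 1" n] z
    by (simp add: add_ac)
  then have "((\<lambda>z. z ^ n * abs_Polygamma n (1 + z)) has_real_derivative ?D) (at z)"
    by (rule DERIV_cong[OF DERIV_mult[OF DERIV_pow]]) (simp add: k algebra_simps)
  moreover have "?D > 0"
    using mult_abs_Polygamma_Suc_less[OF n z] z by (intro mult_pos_pos) auto
  ultimately show "\<exists>D. ((\<lambda>z. z ^ n * abs_Polygamma n (1 + z)) has_real_derivative D) (at z) \<and> D > 0"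
    by blast
qed

text \<open>Substitution of \<open>a * t\<close> for \<open>x\<close>; the constant factor
  \<open>t ^ n\<close> cancels.\<close>

lemma power_mult_abs_Polygamma_scaled_strict_mono:
  assumes "n > 0" "t > 0"
  shows "strict_mono_on {0<..} (\<lambda>a. a ^ n * abs_Polygamma n (1 + a * t))"
proof (rule strict_mono_onI)
  fix a b :: real assume "a \<in> {0<..}" "b \<in> {0<..}" "a < b"
  then have "(a * t) ^ n * abs_Polygamma n (1 + a * t) < (b * t) ^ n * abs_Polygamma n (1 + b * t)"
    using assms by (intro power_mult_abs_Polygamma_strict_mono) auto
  then have "t ^ n * (a ^ n * abs_Polygamma n (1 + a * t)) < t ^ n * (b ^ n * abs_Polygamma n (1 + b * t))"
    by (simp add: power_mult_distrib mult_ac)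
  then show "a ^ n * abs_Polygamma n (1 + a * t) < b ^ n * abs_Polygamma n (1 + b * t)"
    using assms by simp
qed

section \<open>Asymptotics of the digamma function and the trigamma value at 1\<close>

text \<open>The increment of \<open>ln_Gamma\<close> over \<open>[x, x + 1]\<close> is
  \<open>ln x\<close>, so \<open>ln x\<close> is a value of \<open>Digamma\<close> between the
  endpoints; these two values differ by \<open>1 / x\<close>.\<close>

lemma Digamma_plus1_minus_ln_bounds:
  assumes "(x::real) > 0"
  shows "0 \<le> Digamma (1 + x) - ln x" "Digamma (1 + x) - ln x \<le> 1 / x"
proof -
  obtain z where z: "x < z" "z < x + 1" "ln_Gamma (x + 1) - ln_Gamma x = (x + 1 - x) * Digamma z"
    using MVT2[of x "x + 1" ln_Gamma Digamma] assms has_field_derivative_ln_Gamma_real by auto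
  have "ln_Gamma (x + 1) = ln x + ln_Gamma x"
    using assms by (simp add: ln_Gamma_real_pos Gamma_plus1 pos_real_not_nonpos_Int ln_mult Gamma_real_pos
        less_imp_neq[symmetric])
  with z have "ln x = Digamma z" by simp
  moreover have "Digamma x < Digamma z" "Digamma z < Digamma (x + 1)"
    using z assms by (auto intro!: Digamma_real_strict_mono)
  ultimately show "0 \<le> Digamma (1 + x) - ln x" "Digamma (1 + x) - ln x \<le> 1 / x"
    using Digamma_plus1[of x] assms by (simp_all add: add_ac)
qed

text \<open>The bounds give the limit 0 after subtracting \<open>ln (a * t) = ln a + ln t\<close>.
  Only \<open>ln t\<close> is subtracted here because it is common to all \<open>a\<close>.\<close>

lemma tendsto_Digamma_minus_ln_at_top:
  assumes a: "(a::real) > 0"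
  shows "((\<lambda>t. Digamma (1 + a * t) - ln t) \<longlongrightarrow> ln a) at_top"
proof -
  have "((\<lambda>t. Digamma (1 + a * t) - ln (a * t)) \<longlongrightarrow> 0) at_top"
  proof (rule tendsto_sandwich)
    show "\<forall>\<^sub>F t in at_top. 0 \<le> Digamma (1 + a * t) - ln (a * t)"
      "\<forall>\<^sub>F t in at_top. Digamma (1 + a * t) - ln (a * t) \<le> 1 / (a * t)"
      by (rule eventually_mono[OF eventually_gt_at_top[of 0]],
          rule Digamma_plus1_minus_ln_bounds, use a in simp)+
    show "((\<lambda>t. 1 / (a * t)) \<longlongrightarrow> 0) at_top"
      using a by (intro tendsto_divide_0[OF tendsto_const] filterlim_at_top_imp_at_infinity
          filterlim_tendsto_pos_mult_at_top[OF tendsto_const] filterlim_ident)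
  qed simp
  from tendsto_add[OF tendsto_const[of "ln a"] this]
  have "((\<lambda>t. ln a + (Digamma (1 + a * t) - ln (a * t))) \<longlongrightarrow> ln a) at_top" by simp
  then show ?thesis
    by (rule Lim_transform_eventually)
      (rule eventually_mono[OF eventually_gt_at_top[of 0]], use a in \<open>simp add: ln_mult\<close>)
qed

lemma Polygamma_1_1: "Polygamma 1 (1::real) = pi\<^sup>2 / 6"
proof -
  have "(\<lambda>k. inverse ((1 + of_nat k :: real) ^ Suc 1)) sums (Polygamma 1 1)"
    using Polygamma_LIMSEQ[of "1::real" 1] by simp
  moreover have "(\<lambda>k. inverse ((1 + of_nat k :: real) ^ Suc 1)) sums (pi\<^sup>2 / 6)"
    using inverse_squares_sums by (simp add: inverse_eq_divide add.commute flip: power2_eq_square)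
  ultimately show ?thesis by (rule sums_unique2)
qed

section \<open>Monotone functions on the half-line\<close>

text \<open>Comparison with the intermediate point \<open>x / 2\<close> makes the inequality strict:
  the limit is at most \<open>f (x / 2)\<close>.\<close>

lemma strict_mono_on_gt_limit:
  fixes f :: "real \<Rightarrow> real"
  assumes mono: "strict_mono_on {0<..} f" and lim: "(f \<longlongrightarrow> A) (at_right 0)" and x: "x > 0"
  shows "A < f x"
proof -
  have "\<forall>\<^sub>F y in at_right 0. f y \<le> f (x / 2)"
    unfolding eventually_at_right_field
    using x strict_mono_onD[OF mono, of _ "x / 2"] by (intro exI[of _ "x / 2"]) (auto intro: less_imp_le)
  then have "A \<le> f (x / 2)"
    by (intro tendsto_upperbound[OF lim]) auto
  also have "\<dots> < f x" using x by (intro strict_mono_onD[OF mono]) auto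
  finally show ?thesis .
qed

text \<open>The condition at infinity concerns the single value \<open>y\<close>, so that it covers
  both a finite limit above \<open>y\<close> and divergence to infinity.\<close>

lemma between_in_image:
  fixes f :: "real \<Rightarrow> real"
  assumes cont: "continuous_on {0<..} f"
    and lim: "(f \<longlongrightarrow> A) (at_right 0)" and "A < y" and "\<forall>\<^sub>F x in at_top. y < f x"
  shows "y \<in> f ` {0<..}"
proof -
  obtain b where b: "b > 0" "\<And>x. 0 < x \<Longrightarrow> x < b \<Longrightarrow> f x < y"
    using order_tendstoD(2)[OF lim \<open>A < y\<close>] by (auto simp: eventually_at_right_field)
  obtain c where c: "\<And>x. x \<ge> c \<Longrightarrow> y < f x"
    using assms(4) by (auto simp: eventually_at_top_linorder)
  have "\<exists>x\<ge>b / 2. x \<le> max b c \<and> f x = y"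
    using b(2)[of "b / 2"] c[of "max b c"] b(1)
    by (intro IVT' continuous_on_subset[OF cont]) auto
  with b(1) show ?thesis by force
qed

lemma image_strict_mono_at_top:
  fixes f :: "real \<Rightarrow> real"
  assumes "strict_mono_on {0<..} f" "continuous_on {0<..} f"
    and "(f \<longlongrightarrow> A) (at_right 0)" and "filterlim f at_top at_top"
  shows "f ` {0<..} = {A<..}"
  using strict_mono_on_gt_limit[OF assms(1,3)] between_in_image[OF assms(2,3)] assms(4)
  by (auto simp: filterlim_at_top_dense)

lemma image_strict_mono_tendsto:
  fixes f :: "real \<Rightarrow> real"
  assumes mono: "strict_mono_on {0<..} f" and cont: "continuous_on {0<..} f"
    and lim0: "(f \<longlongrightarrow> A) (at_right 0)" and lim: "(f \<longlongrightarrow> B) at_top"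
  shows "f ` {0<..} = {A<..<B}"
proof -
  have "f x < B" if x: "x > 0" for x
  proof -
    have "f x < f (x + 1)" using x by (intro strict_mono_onD[OF mono]) auto
    also have "f (x + 1) \<le> B"
    proof (rule tendsto_lowerbound[OF lim])
      show "\<forall>\<^sub>F y in at_top. f (x + 1) \<le> f y"
        using eventually_gt_at_top[of "x + 1"]
        by eventually_elim (use x strict_mono_onD[OF mono, of "x + 1"] in \<open>force intro: less_imp_le\<close>)
    qed simp
    finally show ?thesis .
  qed
  moreover have "y \<in> f ` {0<..}" if "A < y" "y < B" for y
    using between_in_image[OF cont lim0 that(1)] order_tendstoD(1)[OF lim that(2)] by blast
  ultimately show ?thesis
    using strict_mono_on_gt_limit[OF mono lim0] by auto
qed

text \<open>From some point \<open>T\<close> on, the mean value theorem keeps \<open>f\<close> above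
  a line of slope \<open>c\<close>.\<close>

lemma filterlim_at_top_if_deriv_ge:
  fixes f :: "real \<Rightarrow> real"
  assumes deriv: "\<And>t. t > 0 \<Longrightarrow> (f has_real_derivative f' t) (at t)"
    and "c > 0" and "\<forall>\<^sub>F t in at_top. c \<le> f' t"
  shows "filterlim f at_top at_top"
proof -
  obtain T where T: "T > 0" "\<And>t. t \<ge> T \<Longrightarrow> c \<le> f' t"
    using eventually_conj[OF assms(3) eventually_gt_at_top[of 0]]
    by (auto simp: eventually_at_top_linorder)
  have "f T + c * (t - T) \<le> f t" if t: "t > T" for t
  proof -
    obtain z where "T < z" "z < t" "f t - f T = (t - T) * f' z"
      using MVT2[of T t f f'] deriv T(1) t by auto
    moreover from this have "(t - T) * c \<le> (t - T) * f' z"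
      using T(2) t by (intro mult_left_mono) auto
    ultimately show ?thesis by (simp add: algebra_simps)
  qed
  then have "\<forall>\<^sub>F t in at_top. (f T - c * T) + c * t \<le> f t"
    by (intro eventually_mono[OF eventually_gt_at_top[of T]]) (simp add: algebra_simps)
  moreover have "filterlim (\<lambda>t. (f T - c * T) + c * t) at_top at_top"
    using \<open>c > 0\<close> by (intro filterlim_tendsto_add_at_top[OF tendsto_const]
        filterlim_tendsto_pos_mult_at_top[OF tendsto_const] filterlim_ident)
  ultimately show ?thesis by (rule filterlim_at_top_mono[rotated])
qed

section \<open>Superadditivity of \<open>a * r a\<close> for monotone \<open>r\<close>\<close>

text \<open>No entry exceeds the total, so every \<open>r (x j)\<close> may be replaced by
  \<open>r\<close> of the total.\<close>

lemma sum_mult_le_sum_mult_mono: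
  fixes r :: "real \<Rightarrow> real"
  assumes "finite A" and pos: "\<And>j. j \<in> A \<Longrightarrow> x j > 0" and r: "mono_on {0<..} r"
  shows "(\<Sum>j\<in>A. x j * r (x j)) \<le> sum x A * r (sum x A)"
  unfolding sum_distrib_right
proof (intro sum_mono mult_left_mono)
  fix j assume j: "j \<in> A"
  have "x j \<le> sum x A" by (rule member_le_sum) (use assms j in \<open>auto intro: less_imp_le\<close>)
  with pos[OF j] show "r (x j) \<le> r (sum x A)" by (intro mono_onD[OF r]) auto
qed (use pos in \<open>simp add: less_imp_le\<close>)

lemma sum_mult_less_sum_mult_strict_mono:
  fixes r :: "real \<Rightarrow> real"
  assumes "finite A" and pos: "\<And>j. j \<in> A \<Longrightarrow> x j > 0" and r: "strict_mono_on {0<..} r"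
    and "card A \<ge> 2"
  shows "(\<Sum>j\<in>A. x j * r (x j)) < sum x A * r (sum x A)"
  unfolding sum_distrib_right
proof (intro sum_strict_mono mult_strict_left_mono)
  fix j assume j: "j \<in> A"
  \<comment> \<open>A second positive entry keeps \<open>x j\<close> strictly below the
    total.\<close>
  have "A - {j} \<noteq> {}"
    using \<open>card A \<ge> 2\<close> card_mono[of "{j}" A] by auto
  then have "0 < sum x (A - {j})" by (intro sum_pos) (use assms in auto)
  then have "x j < sum x A" using \<open>finite A\<close> j by (simp add: sum.remove)
  with pos[OF j] show "r (x j) < r (sum x A)" by (intro strict_mono_onD[OF r]) auto
qed (use assms in auto)

section \<open>Weighted sums over a matrix and its margins\<close>

locale positive_matrix =
  fixes m n :: nat
    and lam :: "nat \<Rightarrow> nat \<Rightarrow> real"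
    and \<nu> \<tau> :: "nat \<Rightarrow> real"
    and \<rho> :: real
  assumes dims: "m \<ge> 1" "n \<ge> 1"
    and lam_pos: "\<And>i j. i \<in> {1..m} \<Longrightarrow> j \<in> {1..n} \<Longrightarrow> lam i j > 0"
    and nu: "\<And>i. i \<in> {1..m} \<Longrightarrow> \<nu> i = (\<Sum>j=1..n. lam i j)"
    and tau: "\<And>j. j \<in> {1..n} \<Longrightarrow> \<tau> j = (\<Sum>i=1..m. lam i j)"
begin

text \<open>The common shape of \<open>ln F\<close>, all its derivatives and the endpoints of the
  images. It is linear in \<open>f\<close>, so limits and derivatives can be taken for each
  \<open>a\<close> separately.\<close>

definition margin_sum :: "(real \<Rightarrow> real) \<Rightarrow> real" where
  "margin_sum f = (\<Sum>i=1..m. f (\<nu> i)) + (\<Sum>j=1..n. f (\<tau> j)) - \<rho> * (\<Sum>i=1..m. \<Sum>j=1..n. f (lam i j))"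

lemma nu_pos: "i \<in> {1..m} \<Longrightarrow> \<nu> i > 0"
  unfolding nu by (intro sum_pos lam_pos) (use dims in auto)

lemma tau_pos: "j \<in> {1..n} \<Longrightarrow> \<tau> j > 0"
  unfolding tau by (intro sum_pos lam_pos) (use dims in auto)

lemma margin_sum_cong:
  assumes "\<And>a. a > 0 \<Longrightarrow> f a = g a"
  shows "margin_sum f = margin_sum g"
  unfolding margin_sum_def using assms nu_pos tau_pos lam_pos
  by (intro arg_cong2[of _ _ _ _ "(-)"] arg_cong2[of _ _ _ _ "(+)"] arg_cong2[of _ _ _ _ "(*)"] sum.cong refl) auto

lemma margin_sum_add: "margin_sum (\<lambda>a. f a + g a) = margin_sum f + margin_sum g"
  by (simp add: margin_sum_def sum.distrib algebra_simps)

lemma margin_sum_cmult: "margin_sum (\<lambda>a. c * f a) = c * margin_sum f"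
  by (simp add: margin_sum_def algebra_simps flip: sum_distrib_left)

lemma tendsto_margin_sum:
  assumes "\<And>a. a > 0 \<Longrightarrow> ((\<lambda>t. f t a) \<longlongrightarrow> g a) H"
  shows "((\<lambda>t. margin_sum (f t)) \<longlongrightarrow> margin_sum g) H"
  unfolding margin_sum_def by (intro tendsto_intros assms nu_pos tau_pos lam_pos)

lemma has_real_derivative_margin_sum:
  assumes "\<And>a. a > 0 \<Longrightarrow> ((\<lambda>t. f t a) has_real_derivative f' a) (at t)"
  shows "((\<lambda>t. margin_sum (f t)) has_real_derivative margin_sum f') (at t)"
  unfolding margin_sum_def
  by (intro DERIV_add DERIV_diff DERIV_cmult DERIV_sum assms nu_pos tau_pos lam_pos)

text \<open>Each row and each column is superadditive for \<open>\<lambda>a. a * r a\<close>, and every entry lies in one row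
  and one column; this is where \<open>\<rho> \<le> 2\<close> enters.\<close>
lemma margin_sum_lower_bound:
  assumes r: "mono_on {0<..} r"
  shows "(2 - \<rho>) * (\<Sum>i=1..m. \<Sum>j=1..n. lam i j * r (lam i j)) \<le> margin_sum (\<lambda>a. a * r a)"
    and "strict_mono_on {0<..} r \<Longrightarrow> (m, n) \<noteq> (1, 1) \<Longrightarrow>
      (2 - \<rho>) * (\<Sum>i=1..m. \<Sum>j=1..n. lam i j * r (lam i j)) < margin_sum (\<lambda>a. a * r a)"
proof -
  let ?S = "\<Sum>i=1..m. \<Sum>j=1..n. lam i j * r (lam i j)"
  have S: "?S = (\<Sum>j=1..n. \<Sum>i=1..m. lam i j * r (lam i j))" by (rule sum.swap)
  have rows: "?S \<le> (\<Sum>i=1..m. \<nu> i * r (\<nu> i))"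
    by (intro sum_mono) (unfold nu, intro sum_mult_le_sum_mult_mono r lam_pos, auto)
  have cols: "?S \<le> (\<Sum>j=1..n. \<tau> j * r (\<tau> j))"
    unfolding S by (intro sum_mono) (unfold tau, intro sum_mult_le_sum_mult_mono r lam_pos, auto)
  from rows cols show "(2 - \<rho>) * ?S \<le> margin_sum (\<lambda>a. a * r a)"
    by (simp add: margin_sum_def algebra_simps)
  assume sr: "strict_mono_on {0<..} r" and "(m, n) \<noteq> (1, 1)"
  with dims consider "n \<ge> 2" | "m \<ge> 2" by fastforce
  \<comment> \<open>Rows have length \<open>n\<close> and columns length \<open>m\<close>; one
    strict inequality of the two is enough for the sum.\<close>
  then have "?S < (\<Sum>i=1..m. \<nu> i * r (\<nu> i)) \<or> ?S < (\<Sum>j=1..n. \<tau> j * r (\<tau> j))"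
  proof cases
    case 1
    have "?S < (\<Sum>i=1..m. \<nu> i * r (\<nu> i))"
      by (intro sum_strict_mono)
        (use dims 1 in \<open>unfold nu, auto intro!: sum_mult_less_sum_mult_strict_mono sr lam_pos\<close>)
    then show ?thesis ..
  next
    case 2
    have "?S < (\<Sum>j=1..n. \<tau> j * r (\<tau> j))"
      unfolding S by (intro sum_strict_mono)
        (use dims 2 in \<open>unfold tau, auto intro!: sum_mult_less_sum_mult_strict_mono sr lam_pos\<close>)
    then show ?thesis ..
  qed
  with rows cols show "(2 - \<rho>) * ?S < margin_sum (\<lambda>a. a * r a)"
    by (auto simp: margin_sum_def algebra_simps)
qed

lemma margin_sum_nonneg:
  assumes "\<rho> \<le> 2" "mono_on {0<..} r" "\<And>a. a > 0 \<Longrightarrow> r a > 0"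
  shows "0 \<le> margin_sum (\<lambda>a. a * r a)"
proof -
  have "0 \<le> (2 - \<rho>) * (\<Sum>i=1..m. \<Sum>j=1..n. lam i j * r (lam i j))"
    by (intro mult_nonneg_nonneg sum_nonneg less_imp_le[OF lam_pos] less_imp_le[OF assms(3)] lam_pos)
      (use assms(1) in auto)
  also note margin_sum_lower_bound(1)[OF assms(2)]
  finally show ?thesis .
qed

text \<open>Strictness comes from the positive double sum if \<open>\<rho> < 2\<close>, and from
  strict superadditivity if \<open>\<rho> = 2\<close>. For a single entry and
  \<open>\<rho> = 2\<close> every margin sum is \<open>f a + f a - 2 * f a = 0\<close>, hence the
  exclusion.\<close>

lemma margin_sum_pos:
  assumes "\<rho> \<le> 2" "mono_on {0<..} r" "\<And>a. a > 0 \<Longrightarrow> r a > 0"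
    and "\<rho> < 2 \<or> strict_mono_on {0<..} r" "(m, n, \<rho>) \<noteq> (1, 1, 2)"
  shows "0 < margin_sum (\<lambda>a. a * r a)"
proof (cases "\<rho> < 2")
  case True
  have "0 < (2 - \<rho>) * (\<Sum>i=1..m. \<Sum>j=1..n. lam i j * r (lam i j))"
    by (intro mult_pos_pos sum_pos lam_pos assms(3)) (use True dims in auto)
  also note margin_sum_lower_bound(1)[OF assms(2)]
  finally show ?thesis .
next
  case False
  with assms margin_sum_lower_bound(2)[OF assms(2)] show ?thesis by auto
qed

end

section \<open>The logarithm of the gamma quotient\<close>

locale gamma_quotient = positive_matrix +
  fixes \<theta> :: real
begin

definition log_quotient :: "real \<Rightarrow> real" where
  "log_quotient t = margin_sum (\<lambda>a. a powr \<theta> * ln_Gamma (1 + a * t))"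

text \<open>The index follows \<open>Polygamma\<close>: index \<open>k\<close> stands for the
  derivative of order \<open>k + 1\<close> of \<open>log_quotient\<close>.\<close>

definition log_quotient_deriv :: "nat \<Rightarrow> real \<Rightarrow> real" where
  "log_quotient_deriv k t = margin_sum (\<lambda>a. a powr \<theta> * (a ^ Suc k * Polygamma k (1 + a * t)))"

text \<open>All gamma values are positive, so each power is an exponential of a multiple of
  \<open>ln_Gamma\<close>, and products turn into sums.\<close>

lemma ln_gamma_quotient:
  assumes t: "t > 0"
  shows "(\<Prod>i=1..m. Gamma (1 + \<nu> i * t) powr (\<nu> i powr \<theta>)) *
          (\<Prod>j=1..n. Gamma (1 + \<tau> j * t) powr (\<tau> j powr \<theta>)) /
          (\<Prod>i=1..m. \<Prod>j=1..n. Gamma (1 + lam i j * t) powr (\<rho> * lam i j powr \<theta>)) =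
         exp (log_quotient t)"
proof -
  have *: "Gamma (1 + a * t) powr c = exp (c * ln_Gamma (1 + a * t))" if "a > 0" for a c
    using that t Gamma_real_pos_exp[of "1 + a * t"] by (simp add: powr_def add_pos_pos)
  have "(\<Prod>i=1..m. Gamma (1 + \<nu> i * t) powr (\<nu> i powr \<theta>)) =
      exp (\<Sum>i=1..m. \<nu> i powr \<theta> * ln_Gamma (1 + \<nu> i * t))"
    unfolding exp_sum[OF finite_atLeastAtMost] by (intro prod.cong refl * nu_pos)
  moreover have "(\<Prod>j=1..n. Gamma (1 + \<tau> j * t) powr (\<tau> j powr \<theta>)) =
      exp (\<Sum>j=1..n. \<tau> j powr \<theta> * ln_Gamma (1 + \<tau> j * t))"
    unfolding exp_sum[OF finite_atLeastAtMost] by (intro prod.cong refl * tau_pos)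
  moreover have "(\<Prod>i=1..m. \<Prod>j=1..n. Gamma (1 + lam i j * t) powr (\<rho> * lam i j powr \<theta>)) =
      exp (\<Sum>i=1..m. \<Sum>j=1..n. \<rho> * lam i j powr \<theta> * ln_Gamma (1 + lam i j * t))"
    unfolding exp_sum[OF finite_atLeastAtMost] by (intro prod.cong refl * lam_pos)
  ultimately show ?thesis
    by (simp add: log_quotient_def margin_sum_def exp_add exp_diff sum_distrib_left mult.assoc)
qed

lemma has_real_derivative_log_quotient:
  assumes "t > 0"
  shows "(log_quotient has_real_derivative log_quotient_deriv 0 t) (at t)"
  unfolding log_quotient_def[abs_def] log_quotient_deriv_def
proof (rule has_real_derivative_margin_sum)
  fix a :: real assume "a > 0"
  with assms have pos: "1 + a * t > 0" by (simp add: add_pos_pos)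
  have "((\<lambda>t. 1 + a * t) has_real_derivative a) (at t)"
    by (auto intro!: derivative_eq_intros)
  from DERIV_cmult[OF DERIV_chain2[OF has_field_derivative_ln_Gamma_real[OF pos] this], of "a powr \<theta>"]
  show "((\<lambda>t. a powr \<theta> * ln_Gamma (1 + a * t)) has_real_derivative
      a powr \<theta> * (a ^ Suc 0 * Digamma (1 + a * t))) (at t)"
    by (simp add: mult_ac)
qed

lemma has_real_derivative_log_quotient_deriv:
  assumes "t > 0"
  shows "(log_quotient_deriv k has_real_derivative log_quotient_deriv (Suc k) t) (at t)"
  unfolding log_quotient_deriv_def[abs_def]
proof (rule has_real_derivative_margin_sum)
  fix a :: real assume "a > 0"
  with assms have pos: "1 + a * t > 0" by (simp add: add_pos_pos)
  have "((\<lambda>t. 1 + a * t) has_real_derivative a) (at t)"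
    by (auto intro!: derivative_eq_intros)
  from DERIV_cmult[OF DERIV_cmult[OF DERIV_chain2[OF has_real_derivative_Polygamma[OF pos] this]],
      of "a powr \<theta>" "a ^ Suc k" k]
  show "((\<lambda>t. a powr \<theta> * (a ^ Suc k * Polygamma k (1 + a * t))) has_real_derivative
      a powr \<theta> * (a ^ Suc (Suc k) * Polygamma (Suc k) (1 + a * t))) (at t)"
    by (simp add: mult_ac)
qed

lemma continuous_on_log_quotient: "continuous_on {0<..} log_quotient"
  by (intro continuous_at_imp_continuous_on ballI DERIV_isCont[OF has_real_derivative_log_quotient]) auto

lemma continuous_on_log_quotient_deriv: "continuous_on {0<..} (log_quotient_deriv k)"
  by (intro continuous_at_imp_continuous_on ballI DERIV_isCont[OF has_real_derivative_log_quotient_deriv]) auto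

section \<open>Limits at both ends of the half-line and signs of the derivatives\<close>

lemma tendsto_log_quotient_0: "(log_quotient \<longlongrightarrow> 0) (at_right 0)"
proof -
  have "((\<lambda>t. ln_Gamma (1 + a * t)) \<longlongrightarrow> 0) (at_right 0)" for a :: real
  proof -
    have "isCont ln_Gamma (1::real)"
      by (rule DERIV_isCont[OF has_field_derivative_ln_Gamma_real]) simp
    moreover have "((\<lambda>t. 1 + a * t) \<longlongrightarrow> 1 + a * 0) (at_right 0)" by (intro tendsto_intros)
    ultimately have "((\<lambda>t. ln_Gamma (1 + a * t)) \<longlongrightarrow> ln_Gamma 1) (at_right 0)"
      by (intro isCont_tendsto_compose[of _ ln_Gamma]) simp_all
    then show ?thesis by (simp add: ln_Gamma_real_pos)
  qed
  from tendsto_margin_sum[OF tendsto_mult_left[OF this]]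
  have "((\<lambda>t. margin_sum (\<lambda>a. a powr \<theta> * ln_Gamma (1 + a * t))) \<longlongrightarrow>
      margin_sum (\<lambda>a. a powr \<theta> * 0)) (at_right 0)" .
  then show ?thesis by (simp add: log_quotient_def[abs_def] margin_sum_def)
qed

text \<open>The source of the constants in the images: \<open>Polygamma k 1\<close> is
  \<open>- euler_mascheroni\<close> for \<open>k = 0\<close> and \<open>pi\<^sup>2 / 6\<close> for
  \<open>k = 1\<close>.\<close>

lemma tendsto_log_quotient_deriv_0:
  "(log_quotient_deriv k \<longlongrightarrow> Polygamma k 1 * margin_sum (\<lambda>a. a powr (\<theta> + Suc k))) (at_right 0)"
proof -
  have "((\<lambda>t. 1 + a * t) \<longlongrightarrow> 1 + a * 0) (at_right 0)" for a :: real
    by (intro tendsto_intros)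
  then have "((\<lambda>t. Polygamma k (1 + a * t)) \<longlongrightarrow> Polygamma k 1) (at_right 0)" for a :: real
    by (intro tendsto_Polygamma) (simp_all add: pos_real_not_nonpos_Int)
  from tendsto_margin_sum[OF tendsto_mult_left[OF tendsto_mult_left[OF this]]]
  have "(log_quotient_deriv k \<longlongrightarrow> margin_sum (\<lambda>a. a powr \<theta> * (a ^ Suc k * Polygamma k 1))) (at_right 0)"
    unfolding log_quotient_deriv_def[abs_def] .
  also have "margin_sum (\<lambda>a. a powr \<theta> * (a ^ Suc k * Polygamma k 1)) =
      margin_sum (\<lambda>a. Polygamma k 1 * a powr (\<theta> + Suc k))"
    by (intro margin_sum_cong) (simp add: powr_add powr_realpow del: power_Suc of_nat_Suc)
  finally show ?thesis unfolding margin_sum_cmult .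
qed

lemma tendsto_log_quotient_deriv_Suc_at_top: "(log_quotient_deriv (Suc k) \<longlongrightarrow> 0) at_top"
proof -
  have "((\<lambda>t. Polygamma (Suc k) (1 + a * t)) \<longlongrightarrow> 0) at_top" if "a > 0" for a :: real
  proof -
    have "filterlim (\<lambda>t. 1 + a * t) at_top at_top"
      using that by (intro filterlim_tendsto_add_at_top[OF tendsto_const]
        filterlim_tendsto_pos_mult_at_top[OF tendsto_const] filterlim_ident)
    from filterlim_compose[OF tendsto_abs_Polygamma_at_top this, of k]
    have "((\<lambda>t. (-1) ^ k * abs_Polygamma (Suc k) (1 + a * t)) \<longlongrightarrow> (-1) ^ k * 0) at_top"
      by (rule tendsto_mult_left)
    then show ?thesis by (simp add: abs_Polygamma_def flip: power_add mult.assoc mult_2)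
  qed
  from tendsto_margin_sum[OF tendsto_mult_left[OF tendsto_mult_left[OF this]]]
  have "(log_quotient_deriv (Suc k) \<longlongrightarrow> margin_sum (\<lambda>a. a powr \<theta> * (a ^ Suc (Suc k) * 0))) at_top"
    unfolding log_quotient_deriv_def[abs_def] .
  then show ?thesis by (simp add: margin_sum_def)
qed

text \<open>The coefficient of \<open>ln t\<close> separates the two cases: the logarithmic
  derivative converges if it vanishes and diverges to infinity if it is positive.\<close>

lemma tendsto_log_quotient_deriv_minus_ln_at_top:
  "((\<lambda>t. log_quotient_deriv 0 t - ln t * margin_sum (\<lambda>a. a powr (\<theta> + 1))) \<longlongrightarrow>
    margin_sum (\<lambda>a. a powr (\<theta> + 1) * ln a)) at_top"
proof -
  have "((\<lambda>t. margin_sum (\<lambda>a. a powr (\<theta> + 1) * (Digamma (1 + a * t) - ln t))) \<longlongrightarrow>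
      margin_sum (\<lambda>a. a powr (\<theta> + 1) * ln a)) at_top"
    by (intro tendsto_margin_sum tendsto_mult_left tendsto_Digamma_minus_ln_at_top)
  moreover have "margin_sum (\<lambda>a. a powr (\<theta> + 1) * (Digamma (1 + a * t) - ln t)) =
      log_quotient_deriv 0 t - ln t * margin_sum (\<lambda>a. a powr (\<theta> + 1))" for t
  proof -
    have "margin_sum (\<lambda>a. a powr (\<theta> + 1) * (Digamma (1 + a * t) - ln t)) =
        margin_sum (\<lambda>a. a powr \<theta> * (a ^ Suc 0 * Digamma (1 + a * t)) + (- ln t) * a powr (\<theta> + 1))"
      by (intro margin_sum_cong) (simp add: powr_add algebra_simps)
    then show ?thesis
      unfolding margin_sum_add margin_sum_cmult log_quotient_deriv_def by simp
  qed
  ultimately show ?thesis by simp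
qed

text \<open>One factor \<open>a\<close> is split off to reach the form \<open>a * r a\<close>
  required by the positivity lemmas for margin sums.\<close>

lemma signed_log_quotient_deriv:
  "(-1) ^ k * log_quotient_deriv (Suc k) t =
    margin_sum (\<lambda>a. a * (a powr \<theta> * (a ^ Suc k * abs_Polygamma (Suc k) (1 + a * t))))"
proof -
  have "(-1) ^ k * log_quotient_deriv (Suc k) t =
    margin_sum (\<lambda>a. (-1) ^ k * (a powr \<theta> * (a ^ Suc (Suc k) * Polygamma (Suc k) (1 + a * t))))"
    unfolding margin_sum_cmult log_quotient_deriv_def ..
  also have "\<dots> = margin_sum (\<lambda>a. a * (a powr \<theta> * (a ^ Suc k * abs_Polygamma (Suc k) (1 + a * t))))"
    by (intro margin_sum_cong) (simp add: abs_Polygamma_def)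
  finally show ?thesis .
qed

end

section \<open>Monotonicity, convexity, images and minimum for \<open>\<rho> \<le> 2\<close> and
  \<open>\<theta> \<ge> 0\<close>\<close>

context gamma_quotient
begin

context
  assumes \<rho>_le: "\<rho> \<le> 2" and \<theta>_ge: "\<theta> \<ge> 0"
begin

text \<open>As \<open>\<theta> \<ge> 0\<close>, the factor \<open>a powr \<theta>\<close> is
  positive and nondecreasing; the other factor is strictly increasing.\<close>

lemma powr_mult_abs_Polygamma_strict_mono:
  assumes t: "t > 0"
  shows "strict_mono_on {0<..} (\<lambda>a. a powr \<theta> * (a ^ Suc k * abs_Polygamma (Suc k) (1 + a * t)))"
proof (rule strict_mono_onI)
  fix a b :: real assume ab: "a \<in> {0<..}" "b \<in> {0<..}" "a < b"
  show "a powr \<theta> * (a ^ Suc k * abs_Polygamma (Suc k) (1 + a * t)) <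
      b powr \<theta> * (b ^ Suc k * abs_Polygamma (Suc k) (1 + b * t))"
  proof (rule mult_le_less_imp_less)
    show "a powr \<theta> \<le> b powr \<theta>" using ab \<theta>_ge by (intro powr_mono2) auto
    show "a ^ Suc k * abs_Polygamma (Suc k) (1 + a * t) < b ^ Suc k * abs_Polygamma (Suc k) (1 + b * t)"
      using strict_mono_onD[OF power_mult_abs_Polygamma_scaled_strict_mono[OF _ t] ab] by blast
    show "0 \<le> a ^ Suc k * abs_Polygamma (Suc k) (1 + a * t)"
      using ab t by (intro mult_nonneg_nonneg less_imp_le[OF abs_Polygamma_pos]) (auto intro: add_pos_pos)
  qed (use ab in auto)
qed

lemma powr_mult_abs_Polygamma_pos:
  assumes "t > 0" "a > 0"
  shows "0 < a powr \<theta> * (a ^ Suc k * abs_Polygamma (Suc k) (1 + a * t))"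
  using assms by (intro mult_pos_pos abs_Polygamma_pos add_pos_pos) auto

lemma signed_log_quotient_deriv_nonneg:
  assumes t: "t > 0"
  shows "0 \<le> (-1) ^ k * log_quotient_deriv (Suc k) t"
  unfolding signed_log_quotient_deriv
  by (rule margin_sum_nonneg[OF \<rho>_le strict_mono_on_imp_mono_on[OF
          powr_mult_abs_Polygamma_strict_mono[OF t]] powr_mult_abs_Polygamma_pos[OF t]])

lemma signed_log_quotient_deriv_pos:
  assumes t: "t > 0" and "(m, n, \<rho>) \<noteq> (1, 1, 2)"
  shows "0 < (-1) ^ k * log_quotient_deriv (Suc k) t"
  unfolding signed_log_quotient_deriv
  by (rule margin_sum_pos[OF \<rho>_le strict_mono_on_imp_mono_on[OF
          powr_mult_abs_Polygamma_strict_mono[OF t]] powr_mult_abs_Polygamma_pos[OF t]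
        disjI2[OF powr_mult_abs_Polygamma_strict_mono[OF t]] assms(2)])

lemma has_real_derivative_log_quotient_deriv_0:
  "t > 0 \<Longrightarrow> (log_quotient_deriv 0 has_real_derivative log_quotient_deriv 1 t) (at t)"
  using has_real_derivative_log_quotient_deriv[of t 0] by simp

lemma has_real_derivative_log_quotient_deriv_1:
  "t > 0 \<Longrightarrow> (log_quotient_deriv 1 has_real_derivative log_quotient_deriv 2 t) (at t)"
  using has_real_derivative_log_quotient_deriv[of t 1] by (simp add: numeral_2_eq_2)

lemma log_quotient_deriv_1_nonneg: "t > 0 \<Longrightarrow> 0 \<le> log_quotient_deriv 1 t"
  using signed_log_quotient_deriv_nonneg[of t 0] by simp

lemma log_quotient_deriv_2_nonpos: "t > 0 \<Longrightarrow> log_quotient_deriv 2 t \<le> 0"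
  using signed_log_quotient_deriv_nonneg[of t 1] by (simp add: numeral_2_eq_2)

lemma log_quotient_deriv_1_pos:
  "t > 0 \<Longrightarrow> (m, n, \<rho>) \<noteq> (1, 1, 2) \<Longrightarrow> 0 < log_quotient_deriv 1 t"
  using signed_log_quotient_deriv_pos[of t 0] by simp

lemma log_quotient_deriv_2_neg:
  "t > 0 \<Longrightarrow> (m, n, \<rho>) \<noteq> (1, 1, 2) \<Longrightarrow> log_quotient_deriv 2 t < 0"
  using signed_log_quotient_deriv_pos[of t 1] by (simp add: numeral_2_eq_2)

lemma mono_on_log_quotient_deriv_0: "mono_on {0<..} (log_quotient_deriv 0)"
proof (rule mono_onI)
  fix s t :: real assume st: "s \<in> {0<..}" "t \<in> {0<..}" "s \<le> t"
  show "log_quotient_deriv 0 s \<le> log_quotient_deriv 0 t"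
  proof (rule DERIV_nonneg_imp_nondecreasing[OF st(3)])
    fix x assume "s \<le> x" "x \<le> t"
    with st have "x > 0" by simp
    then show "\<exists>y. (log_quotient_deriv 0 has_real_derivative y) (at x) \<and> 0 \<le> y"
      using has_real_derivative_log_quotient_deriv_0 log_quotient_deriv_1_nonneg by blast
  qed
qed

lemma strict_mono_on_log_quotient_deriv_0:
  assumes "(m, n, \<rho>) \<noteq> (1, 1, 2)"
  shows "strict_mono_on {0<..} (log_quotient_deriv 0)"
proof (rule strict_mono_onI)
  fix s t :: real assume st: "s \<in> {0<..}" "t \<in> {0<..}" "s < t"
  show "log_quotient_deriv 0 s < log_quotient_deriv 0 t"
  proof (rule DERIV_pos_imp_increasing[OF st(3)])
    fix x assume "s \<le> x" "x \<le> t"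
    with st have "x > 0" by simp
    then show "\<exists>y. (log_quotient_deriv 0 has_real_derivative y) (at x) \<and> 0 < y"
      using has_real_derivative_log_quotient_deriv_0 log_quotient_deriv_1_pos[OF _ assms] by blast
  qed
qed

lemma image_log_quotient_deriv_1:
  assumes "(m, n, \<rho>) \<noteq> (1, 1, 2)"
  shows "log_quotient_deriv 1 ` {0<..} = {0<..<pi\<^sup>2 / 6 * margin_sum (\<lambda>a. a powr (\<theta> + 2))}"
proof -
  let ?c = "pi\<^sup>2 / 6 * margin_sum (\<lambda>a. a powr (\<theta> + 2))"
  \<comment> \<open>The function is strictly decreasing, so the image lemma is applied to its
    negative and the interval is reflected back.\<close>
  have "(\<lambda>t. - log_quotient_deriv 1 t) ` {0<..} = {- ?c<..<- 0}"
  proof (rule image_strict_mono_tendsto)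
    show "strict_mono_on {0<..} (\<lambda>t. - log_quotient_deriv 1 t)"
    proof (rule strict_mono_onI)
      fix s t :: real assume st: "s \<in> {0<..}" "t \<in> {0<..}" "s < t"
      have "log_quotient_deriv 1 t < log_quotient_deriv 1 s"
      proof (rule DERIV_neg_imp_decreasing[OF st(3)])
        fix x assume "s \<le> x" "x \<le> t"
        with st have "x > 0" by simp
        then show "\<exists>y. (log_quotient_deriv 1 has_real_derivative y) (at x) \<and> y < 0"
          using has_real_derivative_log_quotient_deriv_1 log_quotient_deriv_2_neg[OF _ assms] by blast
      qed
      then show "- log_quotient_deriv 1 s < - log_quotient_deriv 1 t" by simp
    qed
    show "((\<lambda>t. - log_quotient_deriv 1 t) \<longlongrightarrow> - ?c) (at_right 0)"
      using tendsto_log_quotient_deriv_0[of 1] unfolding Polygamma_1_1 by (intro tendsto_minus) simp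
    show "((\<lambda>t. - log_quotient_deriv 1 t) \<longlongrightarrow> - 0) at_top"
      using tendsto_log_quotient_deriv_Suc_at_top[of 0] by (intro tendsto_minus) simp
  qed (intro continuous_intros continuous_on_log_quotient_deriv)
  then have "uminus ` (\<lambda>t. - log_quotient_deriv 1 t) ` {0<..} = uminus ` {- ?c<..<- 0}" by simp
  then show ?thesis by (simp add: image_image)
qed

text \<open>The vanishing margin sum is a factor of the limit at 0 and the coefficient of
  \<open>ln t\<close> at infinity, so both limits are finite and the lower one is 0.\<close>

lemma image_log_quotient_deriv_0_bounded:
  assumes "(m, n, \<rho>) \<noteq> (1, 1, 2)" and "margin_sum (\<lambda>a. a powr (\<theta> + 1)) = 0"
  shows "log_quotient_deriv 0 ` {0<..} = {0<..<margin_sum (\<lambda>a. a powr (\<theta> + 1) * ln a)}"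
  using tendsto_log_quotient_deriv_0[of 0] tendsto_log_quotient_deriv_minus_ln_at_top assms
  by (intro image_strict_mono_tendsto strict_mono_on_log_quotient_deriv_0 continuous_on_log_quotient_deriv)
    simp_all

lemma margin_sum_powr_pos:
  assumes "\<rho> < 2 \<or> \<theta> > 0" "(m, n, \<rho>) \<noteq> (1, 1, 2)"
  shows "0 < margin_sum (\<lambda>a. a powr (\<theta> + 1))"
proof -
  have "margin_sum (\<lambda>a. a powr (\<theta> + 1)) = margin_sum (\<lambda>a. a * a powr \<theta>)"
    by (intro margin_sum_cong) (simp add: powr_add)
  also have "\<dots> > 0"
  proof (rule margin_sum_pos)
    show "mono_on {0<..} (\<lambda>a. a powr \<theta>)"
      using \<theta>_ge by (intro mono_onI powr_mono2) auto
    show "\<rho> < 2 \<or> strict_mono_on {0<..} (\<lambda>a. a powr \<theta>)"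
      using assms(1) by (auto intro!: strict_mono_onI powr_less_mono2)
  qed (use \<rho>_le assms(2) in auto)
  finally show ?thesis .
qed

lemma filterlim_log_quotient_deriv_0_at_top:
  assumes "\<rho> < 2 \<or> \<theta> > 0" "(m, n, \<rho>) \<noteq> (1, 1, 2)"
  shows "filterlim (log_quotient_deriv 0) at_top at_top"
proof -
  let ?S = "margin_sum (\<lambda>a. a powr (\<theta> + 1))"
  have "filterlim (\<lambda>t. log_quotient_deriv 0 t - ln t * ?S + ln t * ?S) at_top at_top"
    by (intro filterlim_tendsto_add_at_top[OF tendsto_log_quotient_deriv_minus_ln_at_top]
        filterlim_at_top_mult_tendsto_pos[OF tendsto_const margin_sum_powr_pos[OF assms]] ln_at_top)
  then show ?thesis by simp
qed

lemma image_log_quotient_deriv_0_unbounded: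
  assumes "\<rho> < 2 \<or> \<theta> > 0" "(m, n, \<rho>) \<noteq> (1, 1, 2)"
  shows "log_quotient_deriv 0 ` {0<..} = {- euler_mascheroni * margin_sum (\<lambda>a. a powr (\<theta> + 1))<..}"
  using tendsto_log_quotient_deriv_0[of 0] assms
  by (intro image_strict_mono_at_top strict_mono_on_log_quotient_deriv_0 continuous_on_log_quotient_deriv
      filterlim_log_quotient_deriv_0_at_top) simp_all

text \<open>The derivative is nondecreasing, so beyond \<open>t0\<close> it stays above its positive
  value there.\<close>

lemma filterlim_log_quotient_at_top:
  assumes "t0 > 0" "log_quotient_deriv 0 t0 > 0"
  shows "filterlim log_quotient at_top at_top"
proof (rule filterlim_at_top_if_deriv_ge)
  show "\<forall>\<^sub>F t in at_top. log_quotient_deriv 0 t0 \<le> log_quotient_deriv 0 t"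
    using eventually_ge_at_top[of t0]
    by eventually_elim (use mono_onD[OF mono_on_log_quotient_deriv_0, of t0] assms(1) in auto)
qed (use assms in \<open>auto intro: has_real_derivative_log_quotient\<close>)

lemma convex_on_log_quotient: "convex_on {0<..} log_quotient"
  by (rule f''_ge0_imp_convex[OF _ has_real_derivative_log_quotient
        has_real_derivative_log_quotient_deriv_0 log_quotient_deriv_1_nonneg]) auto

lemma concave_on_log_quotient_deriv_0: "concave_on {0<..} (log_quotient_deriv 0)"
  by (rule f''_le0_imp_concave[OF _ has_real_derivative_log_quotient_deriv_0
        has_real_derivative_log_quotient_deriv_1 log_quotient_deriv_2_nonpos]) auto

text \<open>A nondecreasing function with limit 0 at 0 is nonnegative; this argument also covers
  \<open>(m, n, \<rho>) = (1, 1, 2)\<close>.\<close>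

lemma log_quotient_deriv_0_nonneg:
  assumes "margin_sum (\<lambda>a. a powr (\<theta> + 1)) = 0" "t > 0"
  shows "0 \<le> log_quotient_deriv 0 t"
proof (rule tendsto_upperbound)
  show "(log_quotient_deriv 0 \<longlongrightarrow> 0) (at_right 0)"
    using tendsto_log_quotient_deriv_0[of 0] assms(1) by simp
  show "\<forall>\<^sub>F s in at_right 0. log_quotient_deriv 0 s \<le> log_quotient_deriv 0 t"
    unfolding eventually_at_right_field
    using assms(2) mono_onD[OF mono_on_log_quotient_deriv_0, of _ t] by (intro exI[of _ t]) auto
qed simp

lemma mono_on_log_quotient:
  assumes "margin_sum (\<lambda>a. a powr (\<theta> + 1)) = 0"
  shows "mono_on {0<..} log_quotient"
proof (rule mono_onI)
  fix s t :: real assume st: "s \<in> {0<..}" "t \<in> {0<..}" "s \<le> t"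
  show "log_quotient s \<le> log_quotient t"
  proof (rule DERIV_nonneg_imp_nondecreasing[OF st(3)])
    fix x assume "s \<le> x" "x \<le> t"
    with st have "x > 0" by simp
    then show "\<exists>y. (log_quotient has_real_derivative y) (at x) \<and> 0 \<le> y"
      using has_real_derivative_log_quotient log_quotient_deriv_0_nonneg[OF assms] by blast
  qed
qed

lemma log_quotient_deriv_0_pos:
  assumes "(m, n, \<rho>) \<noteq> (1, 1, 2)" "margin_sum (\<lambda>a. a powr (\<theta> + 1)) = 0" "t > 0"
  shows "0 < log_quotient_deriv 0 t"
  using image_log_quotient_deriv_0_bounded[OF assms(1,2)] assms(3) by auto

lemma strict_mono_on_log_quotient:
  assumes "(m, n, \<rho>) \<noteq> (1, 1, 2)" "margin_sum (\<lambda>a. a powr (\<theta> + 1)) = 0"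
  shows "strict_mono_on {0<..} log_quotient"
proof (rule strict_mono_onI)
  fix s t :: real assume st: "s \<in> {0<..}" "t \<in> {0<..}" "s < t"
  show "log_quotient s < log_quotient t"
  proof (rule DERIV_pos_imp_increasing[OF st(3)])
    fix x assume "s \<le> x" "x \<le> t"
    with st have "x > 0" by simp
    then show "\<exists>y. (log_quotient has_real_derivative y) (at x) \<and> 0 < y"
      using has_real_derivative_log_quotient log_quotient_deriv_0_pos[OF assms] by blast
  qed
qed

lemma image_log_quotient:
  assumes "(m, n, \<rho>) \<noteq> (1, 1, 2)" "margin_sum (\<lambda>a. a powr (\<theta> + 1)) = 0"
  shows "log_quotient ` {0<..} = {0<..}"
  by (rule image_strict_mono_at_top[OF strict_mono_on_log_quotient[OF assms] continuous_on_log_quotient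
        tendsto_log_quotient_0 filterlim_log_quotient_at_top[of 1]])
    (simp_all add: log_quotient_deriv_0_pos[OF assms])

lemma ex_strict_minimum_log_quotient:
  assumes "\<rho> < 2 \<or> \<theta> > 0" "(m, n, \<rho>) \<noteq> (1, 1, 2)"
  shows "\<exists>t0>0. \<forall>t>0. t \<noteq> t0 \<longrightarrow> log_quotient t0 < log_quotient t"
proof -
  \<comment> \<open>The image is unbounded above and its lower end is negative, so the derivative
    has a zero.\<close>
  have "0 \<in> log_quotient_deriv 0 ` {0<..}"
    unfolding image_log_quotient_deriv_0_unbounded[OF assms]
    using margin_sum_powr_pos[OF assms] euler_mascheroni_pos by simp
  then obtain t0 where t0: "t0 > 0" "log_quotient_deriv 0 t0 = 0" by auto
  have "log_quotient t0 < log_quotient t" if t: "t > 0" "t \<noteq> t0" for t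
  proof -
    note d = has_real_derivative_log_quotient
    note sm = strict_mono_onD[OF strict_mono_on_log_quotient_deriv_0[OF assms(2)]]
    \<comment> \<open>Ordering the two points by \<open>min\<close> and \<open>max\<close> lets one
      use of the mean value theorem serve both sides of \<open>t0\<close>.\<close>
    have pos: "min t t0 > 0" "min t t0 < max t t0" using t t0(1) by auto
    then obtain z where z: "min t t0 < z" "z < max t t0"
      "log_quotient (max t t0) - log_quotient (min t t0) = (max t t0 - min t t0) * log_quotient_deriv 0 z"
      using MVT2[of "min t t0" "max t t0" log_quotient "log_quotient_deriv 0"] d by auto
    show ?thesis
    proof (cases "t < t0")
      case True
      with z sm[of z t0] t t0 have "log_quotient_deriv 0 z < 0" by auto
      with True z(3) have "log_quotient t0 - log_quotient t < 0" by (simp add: mult_pos_neg)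
      then show ?thesis by simp
    next
      case False
      with z sm[of t0 z] t t0 have "log_quotient_deriv 0 z > 0" by auto
      with False z(3) t have "log_quotient t - log_quotient t0 > 0" by (simp add: mult_pos_pos)
      then show ?thesis by simp
    qed
  qed
  with t0 show ?thesis by blast
qed

end

end

section \<open>Transfer from \<open>log_quotient\<close> to \<open>F\<close> and
  \<open>L\<close>\<close>

text \<open>For \<open>m = n = 1\<close> and \<open>\<rho> = 2\<close> the quotient is constantly 1.
  Strict monotonicity, the open intervals as images, the unique minimum and the divergence at
  infinity then fail, which explains the guards
  \<open>(m, n, \<rho>) \<noteq> (1, 1, 2)\<close>.\<close>

theorem theorem5p2:
  fixes m n :: nat
    and lam :: "nat \<Rightarrow> nat \<Rightarrow> real"
    and \<nu> \<tau> :: "nat \<Rightarrow> real"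
    and \<rho> \<theta> :: real
    and F L :: "real \<Rightarrow> real"
  assumes "m \<ge> 1" and "n \<ge> 1"
    and lam_pos: "\<And>i j. i \<in> {1..m} \<Longrightarrow> j \<in> {1..n} \<Longrightarrow> lam i j > 0"
    and nu: "\<And>i. i \<in> {1..m} \<Longrightarrow> \<nu> i = (\<Sum>j=1..n. lam i j)"
    and tau: "\<And>j. j \<in> {1..n} \<Longrightarrow> \<tau> j = (\<Sum>i=1..m. lam i j)"
    and F: "\<And>t. t > 0 \<Longrightarrow> F t =
          (\<Prod>i=1..m. Gamma (1 + \<nu> i * t) powr (\<nu> i powr \<theta>)) *
          (\<Prod>j=1..n. Gamma (1 + \<tau> j * t) powr (\<tau> j powr \<theta>)) /
          (\<Prod>i=1..m. \<Prod>j=1..n. Gamma (1 + lam i j * t) powr (\<rho> * lam i j powr \<theta>))"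
    and L: "\<And>t. t > 0 \<Longrightarrow> L t = ln (F t)"
  shows
    "\<comment> \<open>the derivatives occurring below exist\<close>
     (\<forall>t>0. F t > 0 \<and> F differentiable (at t) \<and>
        L differentiable (at t) \<and> deriv L differentiable (at t) \<and>
        deriv L t = deriv F t / F t) \<and>
     (\<rho> \<le> 2 \<and> \<theta> \<ge> 0 \<longrightarrow>
        \<comment> \<open>(1)\<close>
        completely_monotonic_on {0<..} (deriv (deriv L)) \<and>
        ((m, n, \<rho>) \<noteq> (1, 1, 2) \<longrightarrow>
           deriv (deriv L) ` {0<..} =
             {0<..<pi\<^sup>2 / 6 * ((\<Sum>i=1..m. \<nu> i powr (\<theta> + 2)) + (\<Sum>j=1..n. \<tau> j powr (\<theta> + 2))
                        - \<rho> * (\<Sum>i=1..m. \<Sum>j=1..n. lam i j powr (\<theta> + 2)))}) \<and>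
        \<comment> \<open>(2)\<close>
        mono_on {0<..} (deriv L) \<and>
        ((m, n, \<rho>) \<noteq> (1, 1, 2) \<longrightarrow> strict_mono_on {0<..} (deriv L)) \<and>
        concave_on {0<..} (deriv L) \<and>
        \<comment> \<open>(2)(a)\<close>
        (\<rho> = 2 \<and> \<theta> = 0 \<longrightarrow>
           ((m, n, \<rho>) \<noteq> (1, 1, 2) \<longrightarrow>
              deriv L ` {0<..} =
                {0<..<ln ((\<Prod>i=1..m. \<nu> i powr \<nu> i) * (\<Prod>j=1..n. \<tau> j powr \<tau> j) /
                          (\<Prod>i=1..m. \<Prod>j=1..n. lam i j powr lam i j)\<^sup>2)}) \<and>
           Bernstein_on {0<..} (deriv L)) \<and>
        \<comment> \<open>(2)(b)\<close>
        (\<rho> < 2 \<or> \<theta> > 0 \<longrightarrow>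
           ((m, n, \<rho>) \<noteq> (1, 1, 2) \<longrightarrow>
              deriv L ` {0<..} =
                {- euler_mascheroni *
                   ((\<Sum>i=1..m. \<nu> i powr (\<theta> + 1)) + (\<Sum>j=1..n. \<tau> j powr (\<theta> + 1))
                    - \<rho> * (\<Sum>i=1..m. \<Sum>j=1..n. lam i j powr (\<theta> + 1)))<..})) \<and>
        \<comment> \<open>(3)\<close>
        log_convex_on {0<..} F \<and>
        \<comment> \<open>(3)(a)\<close>
        (\<rho> = 2 \<and> \<theta> = 0 \<longrightarrow>
           mono_on {0<..} F \<and>
           ((m, n, \<rho>) \<noteq> (1, 1, 2) \<longrightarrow> strict_mono_on {0<..} F \<and> F ` {0<..} = {1<..})) \<and>
        \<comment> \<open>(3)(b)\<close>
        (\<rho> < 2 \<or> \<theta> > 0 \<longrightarrow>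
           (F \<longlongrightarrow> 1) (at_right 0) \<and>
           ((m, n, \<rho>) \<noteq> (1, 1, 2) \<longrightarrow>
              (\<exists>!t. is_arg_min F (\<lambda>t. t > 0) t) \<and> filterlim F at_top at_top)))"
proof -
  interpret gamma_quotient m n lam \<nu> \<tau> \<rho> \<theta>
    by unfold_locales (use assms(1,2) lam_pos nu tau in auto)
  let ?D = log_quotient_deriv
  let ?P = "\<lambda>k. margin_sum (\<lambda>a. a powr (\<theta> + k))"
  have F_eq: "F t = exp (log_quotient t)" if "t > 0" for t
    using F[OF that] ln_gamma_quotient[OF that] by simp
  have L_eq: "L t = log_quotient t" if "t > 0" for t
    using L[OF that] F_eq[OF that] by simp
  \<comment> \<open>\<open>F\<close> is prescribed for positive arguments only; as they form an open
    set, its derivatives there are those of the exponential.\<close>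
  have F_deriv: "(F has_real_derivative exp (log_quotient t) * ?D 0 t) (at t)" if "t > 0" for t
    by (rule has_field_derivative_transform_within_open[of _ _ _ "{0<..}",
        OF DERIV_chain2[OF DERIV_exp has_real_derivative_log_quotient]])
      (use that F_eq in auto)
  have L_deriv: "(L has_real_derivative ?D 0 t) (at t)" if "t > 0" for t
    by (rule has_field_derivative_transform_within_open[of _ _ _ "{0<..}",
        OF has_real_derivative_log_quotient]) (use that L_eq in auto)
  \<comment> \<open>Differentiating again needs the identity near \<open>t\<close>, not just at
    \<open>t\<close>, so the induction keeps \<open>t\<close> arbitrary.\<close>
  have higher: "(deriv ^^ Suc k) L t = ?D k t" if "t > 0" for k t
    using that
  proof (induction k arbitrary: t)
    case 0
    then show ?case using DERIV_imp_deriv[OF L_deriv] by simp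
  next
    case (Suc k)
    have "((deriv ^^ Suc k) L has_real_derivative ?D (Suc k) t) (at t)"
      by (rule has_field_derivative_transform_within_open[of _ _ _ "{0<..}",
          OF has_real_derivative_log_quotient_deriv]) (use Suc in auto)
    then show ?case by (simp add: DERIV_imp_deriv)
  qed
  have higher_deriv: "((deriv ^^ Suc k) L has_real_derivative ?D (Suc k) t) (at t)" if "t > 0" for k t
    by (rule has_field_derivative_transform_within_open[of _ _ _ "{0<..}",
        OF has_real_derivative_log_quotient_deriv]) (use that higher in auto)
  have L1: "deriv L t = ?D 0 t" and L2: "deriv (deriv L) t = ?D 1 t" if "t > 0" for t
    using higher[OF that, of 0] higher[OF that, of 1] by simp_all
  have img: "deriv L ` {0<..} = ?D 0 ` {0<..}" "deriv (deriv L) ` {0<..} = ?D 1 ` {0<..}"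
    using L1 L2 by (auto intro!: image_cong)
  have pow: "(deriv ^^ k) (deriv (deriv L)) = (deriv ^^ Suc (Suc k)) L" for k
    by (simp only: funpow_Suc_right o_apply)
  have exists_derivs: "\<forall>t>0. F t > 0 \<and> F differentiable (at t) \<and>
        L differentiable (at t) \<and> deriv L differentiable (at t) \<and> deriv L t = deriv F t / F t"
    using F_deriv L_deriv higher_deriv[of _ 0] DERIV_imp_deriv[OF F_deriv]
    by (auto simp: F_eq L1 real_differentiable_def)
  have F_lim0: "(F \<longlongrightarrow> 1) (at_right 0)"
  proof -
    have "((\<lambda>t. exp (log_quotient t)) \<longlongrightarrow> exp 0) (at_right 0)"
      by (intro tendsto_exp tendsto_log_quotient_0)
    then have "((\<lambda>t. exp (log_quotient t)) \<longlongrightarrow> 1) (at_right 0)" by simp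
    then show ?thesis
      by (rule Lim_transform_eventually)
        (rule eventually_mono[OF eventually_at_right_less], simp add: F_eq)
  qed
  show ?thesis (is "_ \<and> (_ \<longrightarrow> ?goal)")
  proof (rule conjI[OF exists_derivs], rule impI)
    assume "\<rho> \<le> 2 \<and> \<theta> \<ge> 0"
    then have \<rho>\<theta>: "\<rho> \<le> 2" "\<theta> \<ge> 0" by auto
    \<comment> \<open>Order \<open>k\<close> of \<open>deriv (deriv L)\<close> is order
      \<open>k + 2\<close> of \<open>L\<close>, that is \<open>?D (Suc k)\<close>, whose product
      with \<open>(-1) ^ k\<close> is nonnegative.\<close>
    have cm: "completely_monotonic_on {0<..} (deriv (deriv L))"
      unfolding completely_monotonic_on_def pow real_differentiable_def
      using higher_deriv signed_log_quotient_deriv_nonneg[OF \<rho>\<theta>]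
      by (auto simp: higher simp del: funpow.simps intro!: exI)
    have mono: "mono_on {0<..} (deriv L)"
      using mono_on_log_quotient_deriv_0[OF \<rho>\<theta>] L1 by (simp add: monotone_on_def)
    have strict: "strict_mono_on {0<..} (deriv L)" if "(m, n, \<rho>) \<noteq> (1, 1, 2)"
      using strict_mono_on_log_quotient_deriv_0[OF \<rho>\<theta> that] L1 by (simp add: monotone_on_def)
    have concave: "concave_on {0<..} (deriv L)"
      using concave_on_log_quotient_deriv_0[OF \<rho>\<theta>] L1 
      by (simp add: concave_on_iff convex_def add_pos_nonneg)
    have log_convex: "log_convex_on {0<..} F"
      using convex_on_log_quotient[OF \<rho>\<theta>] exists_derivs
      by (simp add: log_convex_on_def convex_on_def F_eq convex_def)
    \<comment> \<open>The row sums and the column sums each add up to the sum of all entries, which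
      is subtracted twice.\<close>
    have a0: "?P 1 = 0" if "\<rho> = 2" "\<theta> = 0"
    proof -
      have "(\<Sum>i=1..m. \<nu> i) = (\<Sum>i=1..m. \<Sum>j=1..n. lam i j)"
        by (intro sum.cong refl nu)
      moreover have "(\<Sum>j=1..n. \<tau> j) = (\<Sum>j=1..n. \<Sum>i=1..m. lam i j)"
        by (intro sum.cong refl tau)
      moreover have "(\<Sum>j=1..n. \<Sum>i=1..m. lam i j) = (\<Sum>i=1..m. \<Sum>j=1..n. lam i j)"
        by (rule sum.swap)
      moreover have "?P 1 = margin_sum (\<lambda>a. a)"
        using that by (intro margin_sum_cong) simp
      ultimately show ?thesis unfolding margin_sum_def using that(1) by simp
    qed
    \<comment> \<open>Written with exponentials, the coefficient \<open>\<rho> = 2\<close> of the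
      double sum becomes the square in the denominator.\<close>
    have log_eq: "margin_sum (\<lambda>a. a powr (\<theta> + 1) * ln a) =
        ln ((\<Prod>i=1..m. \<nu> i powr \<nu> i) * (\<Prod>j=1..n. \<tau> j powr \<tau> j) /
          (\<Prod>i=1..m. \<Prod>j=1..n. lam i j powr lam i j)\<^sup>2)" if "\<rho> = 2" "\<theta> = 0"
    proof -
      have *: "a powr a = exp (a * ln a)" if "a > 0" for a :: real
        using that by (simp add: powr_def)
      have "(\<Prod>i=1..m. \<nu> i powr \<nu> i) = exp (\<Sum>i=1..m. \<nu> i * ln (\<nu> i))"
        unfolding exp_sum[OF finite_atLeastAtMost] by (intro prod.cong refl * nu_pos)
      moreover have "(\<Prod>j=1..n. \<tau> j powr \<tau> j) = exp (\<Sum>j=1..n. \<tau> j * ln (\<tau> j))"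
        unfolding exp_sum[OF finite_atLeastAtMost] by (intro prod.cong refl * tau_pos)
      moreover have "(\<Prod>i=1..m. \<Prod>j=1..n. lam i j powr lam i j) =
          exp (\<Sum>i=1..m. \<Sum>j=1..n. lam i j * ln (lam i j))"
        unfolding exp_sum[OF finite_atLeastAtMost] by (intro prod.cong refl * lam_pos)
      moreover have "margin_sum (\<lambda>a. a powr (\<theta> + 1) * ln a) = margin_sum (\<lambda>a. a * ln a)"
        using that by (intro margin_sum_cong) simp
      ultimately show ?thesis
        unfolding margin_sum_def using that(1) by (simp flip: exp_add exp_diff exp_double)
    qed
    have bernstein: "Bernstein_on {0<..} (deriv L)" if "\<rho> = 2" "\<theta> = 0"
      unfolding Bernstein_on_def
      using cm log_quotient_deriv_0_nonneg[OF \<rho>\<theta> a0[OF that]] L1 exists_derivs by auto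
    have F_image: "F ` {0<..} = {1<..}" and F_strict: "strict_mono_on {0<..} F"
      if "\<rho> = 2" "\<theta> = 0" "(m, n, \<rho>) \<noteq> (1, 1, 2)"
    proof -
      show "strict_mono_on {0<..} F"
        using strict_mono_on_log_quotient[OF \<rho>\<theta> that(3) a0[OF that(1,2)]]
        by (simp add: monotone_on_def F_eq)
      have "F ` {0<..} = exp ` log_quotient ` {0<..}"
        unfolding image_image by (intro image_cong) (simp_all add: F_eq)
      also have "\<dots> = exp ` {0<..}"
        by (simp only: image_log_quotient[OF \<rho>\<theta> that(3) a0[OF that(1,2)]])
      also have "\<dots> = {1::real<..}"
      proof (intro equalityI subsetI)
        fix x :: real assume "x \<in> {1<..}"
        then show "x \<in> exp ` {0<..}" by (intro image_eqI[of x exp "ln x"]) auto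
      qed auto
      finally show "F ` {0<..} = {1<..}" .
    qed
    have F_mono: "mono_on {0<..} F" if "\<rho> = 2" "\<theta> = 0"
      using mono_on_log_quotient[OF \<rho>\<theta> a0[OF that]] by (simp add: monotone_on_def F_eq)
    have argmin: "\<exists>!t. is_arg_min F (\<lambda>t. t > 0) t"
      if *: "\<rho> < 2 \<or> \<theta> > 0" "(m, n, \<rho>) \<noteq> (1, 1, 2)"
    proof -
      obtain t0 where "t0 > 0" "\<And>t. t > 0 \<Longrightarrow> t \<noteq> t0 \<Longrightarrow> F t0 < F t"
        using ex_strict_minimum_log_quotient[OF \<rho>\<theta> *] by (auto simp: F_eq)
      then show ?thesis
        unfolding is_arg_min_def by (metis order_less_asym order_less_irrefl)
    qed
    have F_at_top: "filterlim F at_top at_top"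
      if "\<rho> < 2 \<or> \<theta> > 0" "(m, n, \<rho>) \<noteq> (1, 1, 2)"
    proof -
      \<comment> \<open>Divergence of the logarithmic derivative supplies a point where it is
        positive, from which \<open>log_quotient\<close> grows without bound.\<close>
      have "\<forall>\<^sub>F t in at_top. t > 0 \<and> ?D 0 t > 0"
        using filterlim_log_quotient_deriv_0_at_top[OF \<rho>\<theta> that] eventually_gt_at_top[of "0::real"]
        by (simp add: filterlim_at_top_dense eventually_conj_iff)
      then obtain t0 where "t0 > 0" "?D 0 t0 > 0"
        by (auto simp: eventually_at_top_linorder)
      from filterlim_compose[OF exp_at_top filterlim_log_quotient_at_top[OF \<rho>\<theta> this]]
      show ?thesis
        by (rule filterlim_cong[THEN iffD1, rotated -1, OF _ refl refl])
          (auto intro!: eventually_mono[OF eventually_gt_at_top[of 0]] simp: F_eq)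
    qed
    have img1: "deriv (deriv L) ` {0<..} = {0<..<pi\<^sup>2 / 6 * ?P 2}" if "(m, n, \<rho>) \<noteq> (1, 1, 2)"
      unfolding img using image_log_quotient_deriv_1[OF \<rho>\<theta> that] by simp
    have img0: "deriv L ` {0<..} = {- euler_mascheroni * ?P 1<..}"
      if "\<rho> < 2 \<or> \<theta> > 0" "(m, n, \<rho>) \<noteq> (1, 1, 2)"
      unfolding img using image_log_quotient_deriv_0_unbounded[OF \<rho>\<theta> that] by simp
    have img0': "deriv L ` {0<..} =
                {0<..<ln ((\<Prod>i=1..m. \<nu> i powr \<nu> i) * (\<Prod>j=1..n. \<tau> j powr \<tau> j) /
                          (\<Prod>i=1..m. \<Prod>j=1..n. lam i j powr lam i j)\<^sup>2)}"
      if "\<rho> = 2" "\<theta> = 0" "(m, n, \<rho>) \<noteq> (1, 1, 2)"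
      unfolding img image_log_quotient_deriv_0_bounded[OF \<rho>\<theta> that(3) a0[OF that(1,2)]]
      by (simp only: log_eq[OF that(1,2)])
    note images = img1[unfolded margin_sum_def] img0[unfolded margin_sum_def] img0'
    show ?goal
      by (intro conjI impI cm mono strict concave images bernstein log_convex F_mono F_strict F_image
          F_lim0 argmin F_at_top; (elim conjE)?; assumption)
  qed
qed

end
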